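(* Let $\tau_1,\tau_2>0$, let $\mathcal{H}_1$ and $\mathcal{H}_2$ be finite-dimensional Hilbert spaces, let $C$ be a Hermitian operator on $\mathcal{H}_1\otimes\mathcal{H}_2$, and let $\rho\in\mathrm{H}_{\geq}(\mathcal{H}_1)$, $\sigma\in\mathrm{H}_{\geq}(\mathcal{H}_2)$ be Hermitian positive semi-definite operators. Define, for $\Gamma\in\mathrm{H}_{\geq}(\mathcal{H}_1\otimes\mathcal{H}_2)$, $$\mathcal{F}^{\tau_1,\tau_2}_0(\Gamma)=\mathrm{Tr}[C\Gamma]+\tau_1\mathcal{E}[\Gamma_1|\rho]+\tau_2\mathcal{E}[\Gamma_2|\sigma].$$ Then the family $\{\mathcal{F}^{\tau_1,\tau_2}_{\varepsilon}\}_{\varepsilon>0}$, where $$\mathcal{F}^{\tau_1,\tau_2}_{\varepsilon}(\Gamma)=\mathrm{Tr}[C\Gamma]+\varepsilon\mathcal{S}[\Gamma]+\tau_1\mathcal{E}[\Gamma_1|\rho]+\tau_2\mathcal{E}[\Gamma_2|\sigma],\qquad \Gamma\in\mathrm{H}_{\geq}(\mathcal{H}_1\otimes\mathcal{H}_2),$$ $\Gamma$-converges to $\mathcal{F}^{\tau_1,\tau_2}_0$ in the weak*-topology as $\varepsilon\to0^+$.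
   Context: $\mathrm{H}_{\geq}(\mathcal{H})$ is the set of Hermitian positive semi-definite operators on $\mathcal{H}$. The partial traces of $\Gamma$ are $\Gamma_1=\mathrm{Tr}_2[\Gamma]$ (on $\mathcal{H}_1$) and $\Gamma_2=\mathrm{Tr}_1[\Gamma]$ (on $\mathcal{H}_2$). The von Neumann entropy is $\mathcal{S}[\Gamma]=\mathrm{Tr}[\Gamma(\log\Gamma-\mathrm{Id})]$. The Umegaki relative entropy of $\gamma_1,\gamma_2\in\mathrm{H}_{\geq}(\mathcal{H})$ is $$\mathcal{E}[\gamma_1|\gamma_2]=\mathrm{Tr}[\gamma_1(\log\gamma_1-\log\gamma_2-\mathrm{Id})+\gamma_2]\ \text{ if }\ker\gamma_2\subset\ker\gamma_1,\qquad \mathcal{E}[\gamma_1|\gamma_2]=+\infty\ \text{ otherwise},$$ with $0\log0=0$ ($\mathrm{Tr}[\gamma_1\log\gamma_2]$ being computed on the range of $\gamma_2$). All functionals take values in $\mathbb{R}\cup\{+\infty\}$. $\Gamma$-convergence: a family $\mathcal{F}_\alpha$ of functionals on a topological space $\mathcal{X}$ $\Gamma$-converges to $\mathcal{F}$ if (i) for every $x_\alpha\to x$, $\mathcal{F}(x)\leq\liminf_\alpha\mathcal{F}_\alpha(x_\alpha)$; and (ii) for every $x\in\mathcal{X}$ there exists $x_\alpha\to x$ with $\mathcal{F}(x)\geq\limsup_\alpha\mathcal{F}_\alpha(x_\alpha)$. Here $\mathcal{X}=\mathrm{H}_{\geq}(\mathcal{H}_1\otimes\mathcal{H}_2)$ with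 the weak*-topology (equal to the norm topology in finite dimension), $\alpha=\varepsilon\to0^+$. *)

theory Defs
  imports "HOL-Analysis.Analysis"
begin

text \<open>
  A finite-dimensional complex Hilbert space is \<^typ>\<open>complex ^ 'a\<close> for a finite index type
  \<^typ>\<open>'a\<close>, operators are square matrices, and the tensor product of \<^typ>\<open>complex ^ 'a\<close> and
  \<^typ>\<open>complex ^ 'b\<close> is \<^typ>\<open>complex ^ ('a \<times> 'b)\<close>, the pair \<open>(i, j)\<close> indexing the basis
  vector \<open>e\<^sub>i \<otimes> e\<^sub>j\<close>.
\<close>

definition hermitian :: "complex^'a^'a \<Rightarrow> bool" where
  "hermitian A \<longleftrightarrow> (\<forall>i j. A $ i $ j = cnj (A $ j $ i))"

definition cinner :: "complex^'a \<Rightarrow> complex^'a \<Rightarrow> complex" where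
  "cinner u v = (\<Sum>i\<in>UNIV. cnj (u $ i) * v $ i)"

definition psd_ops :: "(complex^'a^'a) set" where
  "psd_ops = {A. hermitian A \<and> (\<forall>v. 0 \<le> Re (cinner v (A *v v)))}"

definition op_kernel :: "complex^'a^'a \<Rightarrow> (complex^'a) set" where
  "op_kernel A = {v. A *v v = 0}"

definition ptrace2 :: "complex^('a::finite \<times> 'b::finite)^('a \<times> 'b) \<Rightarrow> complex^'a^'a" where
  "ptrace2 \<Gamma> = (\<chi> i j. \<Sum>k\<in>UNIV. \<Gamma> $ (i, k) $ (j, k))"

definition ptrace1 :: "complex^('a::finite \<times> 'b::finite)^('a \<times> 'b) \<Rightarrow> complex^'b^'b" where
  "ptrace1 \<Gamma> = (\<chi> i j. \<Sum>k\<in>UNIV. \<Gamma> $ (k, i) $ (k, j))"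


subsection \<open>Functional calculus and entropies\<close>

text \<open>
  For Hermitian \<^term>\<open>A\<close>, \<open>f(A)\<close> is the operator acting as multiplication by \<open>f(x)\<close> on the
  eigenspace of each eigenvalue \<open>x\<close>; \<open>is_fun_calc_ex1\<close> shows that it exists and is unique.
\<close>

definition is_fun_calc :: "(real \<Rightarrow> real) \<Rightarrow> complex^'a^'a \<Rightarrow> complex^'a^'a \<Rightarrow> bool" where
  "is_fun_calc f A B \<longleftrightarrow>
     (\<forall>x v. A *v v = complex_of_real x *s v \<longrightarrow> B *v v = complex_of_real (f x) *s v)"

definition fun_calc :: "(real \<Rightarrow> real) \<Rightarrow> complex^'a^'a \<Rightarrow> complex^'a^'a" where
  "fun_calc f A = (THE B. is_fun_calc f A B)"

lemma hermitian_self_adjoint: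
  assumes "hermitian A"
  shows "inner (A *v v) w = inner v (A *v w)"
proof -
  have in_eq: "inner a b = Re (cnj a * b)" for a b :: complex
    by (simp add: inner_complex_def)
  have "inner (A *v v) w = (\<Sum>i\<in>UNIV. \<Sum>j\<in>UNIV. Re (cnj (A $ i $ j) * cnj (v $ j) * w $ i))"
    by (simp add: inner_vec_def in_eq matrix_vector_mult_def sum_distrib_right
        del: complex_cnj_mult flip: Re_sum, simp add: Re_sum sum_distrib_right algebra_simps)
  also have "\<dots> = (\<Sum>j\<in>UNIV. \<Sum>i\<in>UNIV. Re (cnj (A $ i $ j) * cnj (v $ j) * w $ i))"
    by (rule sum.swap)
  also have "\<dots> = (\<Sum>j\<in>UNIV. \<Sum>i\<in>UNIV. Re (cnj (v $ j) * (A $ j $ i * w $ i)))"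
    using assms unfolding hermitian_def
    by (intro sum.cong refl) (metis mult.assoc mult.commute complex_cnj_cnj)
  also have "\<dots> = inner v (A *v w)"
    by (simp only: inner_vec_def in_eq matrix_vector_mult_def vec_lambda_beta sum_distrib_left Re_sum)
  finally show ?thesis .
qed

lemma cscale_real: "complex_of_real x *s v = x *\<^sub>R v"
  by (simp add: vec_eq_iff scaleR_conv_of_real[where 'a = complex])

lemma hermitian_eigenvector_exists:
  fixes A :: "complex^'a^'a"
  assumes "hermitian A" and S: "subspace S" and inv: "\<And>v. v \<in> S \<Longrightarrow> A *v v \<in> S"
    and ne: "\<exists>v\<in>S. v \<noteq> 0"
  obtains x v where "v \<in> S" "v \<noteq> 0" "A *v v = complex_of_real x *s v"
proof -
  define q where "q v = inner (A *v v) v" for v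
  have bl: "linear ((*v) A)"
    by (rule linearI) (simp_all add: matrix_vector_right_distrib flip: cscale_real,
        simp add: vec_eq_iff matrix_vector_mult_def sum_distrib_left algebra_simps)
  have cont: "continuous_on T q" for T
    unfolding q_def by (intro continuous_intros linear_continuous_on linear_linear[THEN iffD2] bl)
  let ?K = "S \<inter> sphere 0 1"
  obtain u where u: "u \<in> S" "u \<noteq> 0" using ne by blast
  have "(1 / norm u) *\<^sub>R u \<in> ?K" using u S by (simp add: subspace_scale)
  moreover have "compact ?K" by (simp add: S closed_subspace closed_Int_compact)
  ultimately obtain v where v: "v \<in> ?K" "\<And>w. w \<in> ?K \<Longrightarrow> q w \<le> q v"
    using continuous_attains_sup[OF _ _ cont] by (metis empty_iff)
  have nv: "inner v v = 1" "v \<in> S" using v(1) by (auto simp: norm_eq_1)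
  have le: "q w \<le> q v * inner w w" if "w \<in> S" for w
  proof (cases "w = 0")
    case False
    have "(1 / norm w) *\<^sub>R w \<in> ?K" using that False S by (simp add: subspace_scale)
    from v(2)[OF this] have "q w / (norm w)\<^sup>2 \<le> q v"
      by (simp add: q_def linear_scale[OF bl] power2_eq_square)
    with False show ?thesis by (simp add: divide_simps power2_norm_eq_inner)
  qed (simp add: q_def)
  define z where "z = A *v v - q v *\<^sub>R v"
  have zS: "z \<in> S" unfolding z_def using nv inv S by (simp add: subspace_diff subspace_scale)
  have expand: "2 * t * inner z z \<le> t\<^sup>2 * (q v * inner z z - q z)" for t
  proof -
    have "v + t *\<^sub>R z \<in> S" using nv zS S by (simp add: subspace_add subspace_scale)
    from le[OF this] have e1: "q (v + t *\<^sub>R z) \<le> q v * inner (v + t *\<^sub>R z) (v + t *\<^sub>R z)" .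
    have e2: "q (v + t *\<^sub>R z) = q v + 2 * t * inner (A *v v) z + t\<^sup>2 * q z"
      using hermitian_self_adjoint[OF assms(1), of z v]
      by (simp add: q_def linear_add[OF bl] linear_scale[OF bl] inner_add inner_commute
          power2_eq_square algebra_simps)
    have e3: "inner (v + t *\<^sub>R z) (v + t *\<^sub>R z) = 1 + 2 * t * inner v z + t\<^sup>2 * inner z z"
      by (simp add: inner_add nv inner_commute power2_eq_square algebra_simps)
    have e4: "inner z z = inner (A *v v) z - q v * inner v z"
      by (subst (1) z_def) (simp add: inner_diff_left)
    have "2 * t * inner z z = 2 * t * inner (A *v v) z - q v * (2 * t * inner v z)"
      by (simp only: e4 right_diff_distrib mult_ac)
    moreover have "q v + 2 * t * inner (A *v v) z + t\<^sup>2 * q z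
        \<le> q v * 1 + q v * (2 * t * inner v z) + t\<^sup>2 * (q v * inner z z)"
      using e1 unfolding e2 e3 by (simp only: distrib_left mult_ac)
    ultimately show ?thesis by (simp add: right_diff_distrib)
  qed
  have "inner z z = 0"
  proof (rule ccontr)
    assume "inner z z \<noteq> 0"
    then have pos: "inner z z > 0" by (simp add: order_less_le)
    define c where "c = q v * inner z z - q z"
    define t where "t = inner z z / (\<bar>c\<bar> + 1)"
    have "t > 0" using pos by (simp add: t_def)
    have "t * (2 * inner z z) \<le> t * (t * c)"
      using expand[of t] by (simp only: c_def power2_eq_square mult_ac)
    with \<open>t > 0\<close> have "2 * inner z z \<le> t * c" by simp
    also have "\<dots> \<le> t * (\<bar>c\<bar> + 1)" using \<open>t > 0\<close> by (intro mult_left_mono) auto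
    also have "\<dots> = inner z z" by (simp add: t_def)
    finally show False using pos by simp
  qed
  then have "A *v v = complex_of_real (q v) *s v" by (simp add: z_def cscale_real)
  moreover have "v \<noteq> 0" using nv by auto
  ultimately show thesis using that nv by blast
qed

lemma hermitian_eigenvectors_span:
  fixes A :: "complex^'a^'a"
  assumes "hermitian A"
  shows "vec.span {v. \<exists>x. A *v v = complex_of_real x *s v} = UNIV" (is "vec.span ?E = UNIV")
proof -
  define S where "S = {w. \<forall>v\<in>?E. inner v w = 0}"
  have "subspace S" by (auto simp: S_def subspace_def inner_add_right)
  moreover have "A *v w \<in> S" if "w \<in> S" for w
    using that by (auto simp: S_def cscale_real simp flip: hermitian_self_adjoint[OF assms])
  moreover have "w = 0" if "w \<in> S" "A *v w = complex_of_real x *s w" for w x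
    using that by (auto simp: S_def)
  ultimately have S0: "\<And>w. w \<in> S \<Longrightarrow> w = 0"
    using hermitian_eigenvector_exists[OF assms, of S] by metis
  have "w \<in> span ?E" for w
  proof -
    obtain y z where yz: "y \<in> span ?E" "\<And>w. w \<in> span ?E \<Longrightarrow> orthogonal z w" "w = y + z"
      using orthogonal_subspace_decomp_exists by blast
    then have "z \<in> S" by (auto simp: S_def orthogonal_def inner_commute span_base)
    then have "z = 0" by (rule S0)
    with yz show ?thesis by simp
  qed
  moreover have "span ?E \<subseteq> vec.span ?E"
    by (rule span_minimal) (auto simp: subspace_def vec.span_base vec.span_zero vec.span_add
        simp flip: cscale_real intro: vec.span_scale)
  ultimately show ?thesis by blast
qed

lemma is_fun_calc_ex1:
  fixes A :: "complex^'a^'a"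
  assumes "hermitian A"
  shows "\<exists>!B. is_fun_calc f A B"
proof -
  let ?E = "{v. \<exists>x. A *v v = complex_of_real x *s v}"
  note span = hermitian_eigenvectors_span[OF assms]
  obtain B where B: "B \<subseteq> ?E" "vec.independent B" "?E \<subseteq> vec.span B"
    using vec.maximal_independent_subset by blast
  have fin: "finite B" using B(2) by (rule vec.finiteI_independent)
  have spanB: "vec.span B = UNIV"
    using span vec.span_mono[OF B(3)] by (simp add: vec.span_span) blast
  have "\<forall>b\<in>B. \<exists>x. A *v b = complex_of_real x *s b" using B(1) by blast
  then obtain ev where ev: "\<And>b. b \<in> B \<Longrightarrow> A *v b = complex_of_real (ev b) *s b"
    using bchoice[of B "\<lambda>b x. A *v b = complex_of_real x *s b"] by blast
  obtain g where g: "Vector_Spaces.linear (*s) (*s) g" "\<And>b. b \<in> B \<Longrightarrow> g b = complex_of_real (f (ev b)) *s b"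
    using vec.linear_independent_extend[OF B(2), of "\<lambda>b. complex_of_real (f (ev b)) *s b"] by auto
  have gm: "matrix g *v v = g v" for v by (rule matrix_works[OF g(1)])
  have "is_fun_calc f A (matrix g)"
    unfolding is_fun_calc_def
  proof (intro allI impI)
    fix x v assume Av: "A *v v = complex_of_real x *s v"
    obtain c where c: "v = (\<Sum>b\<in>B. c b *s b)"
      using spanB vec.span_finite[OF fin] by (metis (no_types, lifting) UNIV_I imageE)
    have "(\<Sum>b\<in>B. (c b * (complex_of_real (ev b) - complex_of_real x)) *s b)
        = A *v v - complex_of_real x *s v"
      by (subst (1 2) c)
        (simp add: vec.sum vec.scale ev vec.scale_sum_right sum_subtractf[symmetric]
          vec.scale_left_diff_distrib algebra_simps)
    then have "(\<Sum>b\<in>B. (c b * (complex_of_real (ev b) - complex_of_real x)) *s b) = 0"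
      using Av by simp
    from vec.independentD[OF B(2) fin subset_refl this]
    have "\<And>b. b \<in> B \<Longrightarrow> c b = 0 \<or> ev b = x" by auto
    then have "(\<Sum>b\<in>B. c b *s g b) = (\<Sum>b\<in>B. c b *s (complex_of_real (f x) *s b))"
      by (intro sum.cong refl) (auto simp: g(2))
    then show "matrix g *v v = complex_of_real (f x) *s v"
      by (subst (1 2) c) (simp add: vec.sum vec.scale gm vec.scale_sum_right mult.commute)
  qed
  moreover have "B1 = B2" if 1: "is_fun_calc f A B1" and 2: "is_fun_calc f A B2" for B1 B2
  proof -
    have "?E \<subseteq> {v. B1 *v v = B2 *v v}"
      using 1 2 unfolding is_fun_calc_def by (smt (verit) mem_Collect_eq subsetI)
    moreover have "vec.subspace {v. B1 *v v = B2 *v v}"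
      by (auto simp: vec.subspace_def matrix_vector_right_distrib vec.scale)
    ultimately have "vec.span ?E \<subseteq> {v. B1 *v v = B2 *v v}" by (rule vec.span_minimal)
    then have "B1 *v v = B2 *v v" for v using span by blast
    then show ?thesis by (simp add: matrix_eq)
  qed
  ultimately show ?thesis by blast
qed

text \<open>
  The logarithm is set to \<open>0\<close> on the kernel. This gives \<open>0 log 0 = 0\<close>, and makes
  \<open>Tr[\<gamma>\<^sub>1 log \<gamma>\<^sub>2]\<close> the trace computed on the range of \<open>\<gamma>\<^sub>2\<close>.
\<close>

definition op_log :: "complex^'a^'a \<Rightarrow> complex^'a^'a" where
  "op_log = fun_calc (\<lambda>x. if x = 0 then 0 else ln x)"

text \<open>The traces below are real on the operators concerned; \<^const>\<open>Re\<close> only changes the type.\<close>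

definition vn_entropy :: "complex^'a^'a \<Rightarrow> real" where
  "vn_entropy \<Gamma> = Re (trace (\<Gamma> ** (op_log \<Gamma> - mat 1)))"

definition rel_entropy :: "complex^'a^'a \<Rightarrow> complex^'a^'a \<Rightarrow> ereal" where
  "rel_entropy \<gamma>1 \<gamma>2 =
     (if op_kernel \<gamma>2 \<subseteq> op_kernel \<gamma>1
      then ereal (Re (trace (\<gamma>1 ** (op_log \<gamma>1 - op_log \<gamma>2 - mat 1) + \<gamma>2)))
      else \<infinity>)"

definition cost0 ::
  "real \<Rightarrow> real \<Rightarrow> complex^('a::finite \<times> 'b::finite)^('a \<times> 'b) \<Rightarrow> complex^'a^'a \<Rightarrow> complex^'b^'b \<Rightarrow>
   complex^('a::finite \<times> 'b::finite)^('a \<times> 'b) \<Rightarrow> ereal" where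
  "cost0 \<tau>1 \<tau>2 C \<rho> \<sigma> \<Gamma> =
     ereal (Re (trace (C ** \<Gamma>)))
     + ereal \<tau>1 * rel_entropy (ptrace2 \<Gamma>) \<rho> + ereal \<tau>2 * rel_entropy (ptrace1 \<Gamma>) \<sigma>"

definition cost ::
  "real \<Rightarrow> real \<Rightarrow> complex^('a::finite \<times> 'b::finite)^('a \<times> 'b) \<Rightarrow> complex^'a^'a \<Rightarrow> complex^'b^'b \<Rightarrow>
   real \<Rightarrow> complex^('a::finite \<times> 'b::finite)^('a \<times> 'b) \<Rightarrow> ereal" where
  "cost \<tau>1 \<tau>2 C \<rho> \<sigma> \<epsilon> \<Gamma> =
     ereal (Re (trace (C ** \<Gamma>))) + ereal (\<epsilon> * vn_entropy \<Gamma>)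
     + ereal \<tau>1 * rel_entropy (ptrace2 \<Gamma>) \<rho> + ereal \<tau>2 * rel_entropy (ptrace1 \<Gamma>) \<sigma>"


subsection \<open>Weak* topology and Gamma-convergence\<close>

text \<open>
  The coarsest topology making \<open>\<Gamma> \<mapsto> Tr[K \<Gamma>]\<close> continuous for every operator \<open>K\<close>, that is, the
  weak* topology on the trace-class operators as the dual of the compact ones.
\<close>

definition weak_star_topology :: "(complex^'a^'a) topology" where
  "weak_star_topology =
     topology_generated_by {{\<Gamma>. trace (K ** \<Gamma>) \<in> U} | K U. open U}"

lemma trace_matrix_unit:
  fixes \<Gamma> :: "complex^'a^'a"
  shows "trace ((\<chi> k l. if k = j \<and> l = i then 1 else 0) ** \<Gamma>) = \<Gamma> $ i $ j"
proof -
  have "trace ((\<chi> k l. if k = j \<and> l = i then 1 else 0) ** \<Gamma>)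
      = (\<Sum>k\<in>UNIV. \<Sum>l\<in>UNIV. if k = j then if l = i then \<Gamma> $ l $ k else 0 else 0)"
    by (auto simp: trace_def matrix_matrix_mult_def intro!: sum.cong)
  also have "\<dots> = (\<Sum>k\<in>UNIV. if k = j then (\<Sum>l\<in>UNIV. if l = i then \<Gamma> $ l $ k else 0) else 0)"
    by (intro sum.cong) auto
  finally show ?thesis by simp
qed

lemma weak_star_topology_eq_euclidean:
  "weak_star_topology = (euclidean :: (complex^'a^'a) topology)"
proof -
  let ?G = "{{\<Gamma> :: complex^'a^'a. trace (K ** \<Gamma>) \<in> U} | K U. open U}"
  have 1: "openin weak_star_topology S \<longleftrightarrow> generate_topology_on ?G S" for S
    by (simp add: weak_star_topology_def openin_topology_generated_by_iff)
  have "open S" if "generate_topology_on ?G S" for S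
    using that
  proof induction
    case (Basis S)
    then obtain K U where S: "S = {\<Gamma>. trace (K ** \<Gamma>) \<in> U}" "open U" by blast
    have "continuous_on UNIV (\<lambda>\<Gamma>. trace (K ** \<Gamma>))"
      by (simp add: trace_def matrix_matrix_mult_def) (intro continuous_intros)
    from open_vimage[OF S(2) this] show ?case by (simp add: S(1) vimage_def)
  qed auto
  moreover have "openin weak_star_topology S" if "open S" for S :: "(complex^'a^'a) set"
  proof (subst openin_subopen, intro ballI)
    fix \<Gamma> assume "\<Gamma> \<in> S"
    with \<open>open S\<close> obtain P where P: "\<And>i. open (P i)" "\<And>i. \<Gamma> $ i \<in> P i"
        "\<And>\<Delta>. (\<forall>i. \<Delta> $ i \<in> P i) \<Longrightarrow> \<Delta> \<in> S"
      unfolding open_vec_def by metis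
    have "\<forall>i. \<exists>Q. (\<forall>j. open (Q j) \<and> \<Gamma> $ i $ j \<in> Q j) \<and> (\<forall>y. (\<forall>j. y $ j \<in> Q j) \<longrightarrow> y \<in> P i)"
      using P(1,2) unfolding open_vec_def by blast
    then obtain Q where Q: "\<And>i j. open (Q i j)" "\<And>i j. \<Gamma> $ i $ j \<in> Q i j"
        "\<And>i y. (\<forall>j. y $ j \<in> Q i j) \<Longrightarrow> y \<in> P i"
      by metis
    let ?V = "\<lambda>i j. {\<Delta> :: complex^'a^'a. \<Delta> $ i $ j \<in> Q i j}"
    have "openin weak_star_topology (?V i j)" for i j
      unfolding 1
    proof (rule generate_topology_on.Basis, intro CollectI exI conjI)
      show "?V i j = {\<Delta>. trace ((\<chi> k l. if k = j \<and> l = i then 1 else 0) ** \<Delta>) \<in> Q i j}"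
        by (simp only: trace_matrix_unit)
    qed (rule Q)
    then have "openin weak_star_topology (\<Inter>(i, j)\<in>UNIV. ?V i j)"
      by (intro openin_INT2) auto
    moreover have "\<Gamma> \<in> (\<Inter>(i, j)\<in>UNIV. ?V i j)" "(\<Inter>(i, j)\<in>UNIV. ?V i j) \<subseteq> S"
      using P(3) Q(2,3) by auto
    ultimately show "\<exists>T. openin weak_star_topology T \<and> \<Gamma> \<in> T \<and> T \<subseteq> S" by blast
  qed
  ultimately show ?thesis
    by (intro topology_eq[THEN iffD2]) (auto simp: 1)
qed

text \<open>\<open>Fs i\<close> Gamma-converges to \<open>F\<close> on the space \<open>X\<close> as \<open>i\<close> tends along the filter \<open>\<alpha>\<close>.\<close>

definition Gamma_converges ::
  "'x topology \<Rightarrow> ('i \<Rightarrow> 'x \<Rightarrow> ereal) \<Rightarrow> ('x \<Rightarrow> ereal) \<Rightarrow> 'i filter \<Rightarrow> bool" where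
  "Gamma_converges X Fs F \<alpha> \<longleftrightarrow>
     (\<forall>x\<in>topspace X. \<forall>u. limitin X u x \<alpha> \<longrightarrow> F x \<le> Liminf \<alpha> (\<lambda>i. Fs i (u i))) \<and>
     (\<forall>x\<in>topspace X. \<exists>u. limitin X u x \<alpha> \<and> Limsup \<alpha> (\<lambda>i. Fs i (u i)) \<le> F x)"

end

theory Submission
  imports Defs "HOL-Real_Asymp.Real_Asymp"
begin

text \<open>
  Everything rests on a lower bound for \<open>Tr[\<Gamma> log \<Gamma>]\<close> near a fixed \<open>\<gamma>\<close>. By Peierls' inequality
  \<open>Tr[\<Gamma> log \<Gamma>] \<ge> \<Sum>\<^sub>b \<langle>b, \<Gamma> b\<rangle> ln \<langle>b, \<Gamma> b\<rangle>\<close> for every orthonormal basis, with equality at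
  \<open>\<Gamma> = \<gamma>\<close> if the basis consists of eigenvectors of \<open>\<gamma>\<close>; the right-hand side is continuous in
  \<open>\<Gamma>\<close>. So \<open>\<Gamma> \<mapsto> Tr[\<Gamma> log \<Gamma>]\<close> is lower semicontinuous, and since the kernel condition is closed,
  so is the relative entropy in its first argument. The same minorant bounds \<open>\<epsilon> S[\<Gamma>\<^sub>\<epsilon>]\<close> from
  below by a quantity tending to \<open>0\<close>, which gives the liminf inequality. Constant families are
  recovery families.

  The space \<^typ>\<open>complex^'n\<close> is treated as a real Euclidean space of twice the dimension: the
  eigenvectors of a Hermitian operator contain an orthonormal basis for the real inner product,
  and the real trace is twice the real part of the complex one.
\<close>

section \<open>Orthonormal eigenbases and the real trace\<close>

text \<open>Take an orthonormal set of eigenvectors of greatest cardinality. Its orthogonal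
  complement is invariant because \<open>A\<close> is self-adjoint, so a nonzero complement would
  contain a further eigenvector. Orthogonality and span are real: \<open>v\<close> and
  \<open>\<i> *s v\<close> are orthogonal here and count separately.\<close>

lemma hermitian_orthonormal_eigenbasis:
  fixes A :: "complex^'n^'n"
  assumes "hermitian A"
  obtains B ev where "finite B" "pairwise orthogonal B" "\<And>b. b \<in> B \<Longrightarrow> norm b = 1"
    "span B = UNIV" "\<And>b. b \<in> B \<Longrightarrow> A *v b = complex_of_real (ev b) *s b"
proof -
  define P where "P B \<longleftrightarrow> pairwise orthogonal B \<and>
    (\<forall>b\<in>B. norm b = 1 \<and> (\<exists>x. A *v b = complex_of_real x *s b))" for B
  have indep: "independent B" if "P B" for B
    using that by (intro pairwise_orthogonal_independent) (auto simp: P_def)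
  have "P {}" by (simp add: P_def)
  \<comment> \<open>Orthonormal sets are independent, so the real dimension bounds their size and a
    largest one exists.\<close>
  moreover have "\<forall>B. P B \<longrightarrow> card B < Suc DIM(complex^'n)"
    using indep independent_card_le le_imp_less_Suc by blast
  ultimately obtain B where B: "P B" "\<And>B'. P B' \<Longrightarrow> card B' \<le> card B"
    using ex_has_greatest_nat[of P "{}" card "Suc DIM(complex^'n)"] by metis
  have fin: "finite B" using indep[OF B(1)] by (rule independent_imp_finite)
  define S where "S = {y. \<forall>b\<in>B. orthogonal b y}"
  have "S \<subseteq> {0}"
  proof (rule ccontr)
    assume "\<not> S \<subseteq> {0}"
    then have ne: "\<exists>v\<in>S. v \<noteq> 0" by auto
    have S: "subspace S" unfolding S_def by (rule subspace_orthogonal_to_vectors)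
    have inv: "A *v v \<in> S" if "v \<in> S" for v
      unfolding S_def
    proof (intro CollectI ballI)
      fix b assume b: "b \<in> B"
      then obtain x where "A *v b = complex_of_real x *s b" using B(1) by (auto simp: P_def)
      then show "orthogonal b (A *v v)"
        using that b by (simp add: orthogonal_def S_def cscale_real
            flip: hermitian_self_adjoint[OF assms])
    qed
    obtain x v where v: "v \<in> S" "v \<noteq> 0" "A *v v = complex_of_real x *s v"
      using hermitian_eigenvector_exists[OF assms S inv ne] by blast
    define w where "w = (1 / norm v) *\<^sub>R v"
    have w: "norm w = 1" "w \<in> S"
      using v S by (simp_all add: w_def subspace_scale)
    have "A *v w = complex_of_real x *s w"
      using v(3) by (simp add: w_def cscale_real linear_scale[OF matrix_vector_mul_linear])
    moreover have "orthogonal b w \<and> orthogonal w b" if "b \<in> B" for b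
      using w(2) that by (auto simp: S_def orthogonal_commute)
    ultimately have "P (insert w B)"
      using B(1) w(1) unfolding P_def pairwise_insert by auto
    moreover have "w \<notin> B" using w by (auto simp: S_def orthogonal_self)
    ultimately show False using B(2)[of "insert w B"] fin by simp
  qed
  moreover have "w \<in> span B" if "S \<subseteq> {0}" for w
  proof -
    obtain y z where yz: "y \<in> span B" "\<And>w. w \<in> span B \<Longrightarrow> orthogonal z w" "w = y + z"
      using orthogonal_subspace_decomp_exists by blast
    then have "z \<in> S" by (auto simp: S_def orthogonal_commute span_base)
    with that yz show ?thesis by auto
  qed
  ultimately have span: "span B = UNIV" by auto
  have "\<forall>b\<in>B. \<exists>x. A *v b = complex_of_real x *s b" using B(1) by (simp add: P_def)
  then obtain ev where "\<And>b. b \<in> B \<Longrightarrow> A *v b = complex_of_real (ev b) *s b"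
    using bchoice[of B "\<lambda>b x. A *v b = complex_of_real x *s b"] by blast
  with fin B(1) span show thesis by (intro that[of B ev]) (auto simp: P_def)
qed

text \<open>Parseval's identity, from expanding \<open>x\<close> in \<open>B\<close>.\<close>

lemma inner_orthonormal_expand:
  fixes B :: "'a::real_inner set"
  assumes "finite B" "pairwise orthogonal B" "\<And>b. b \<in> B \<Longrightarrow> norm b = 1" "span B = UNIV"
  shows "inner x y = (\<Sum>b\<in>B. inner x b * inner y b)"
proof -
  have "x = (\<Sum>b\<in>B. inner x b *\<^sub>R b)"
    using orthonormal_basis_expand[of B x] assms by simp
  then have "inner x y = inner (\<Sum>b\<in>B. inner x b *\<^sub>R b) y" by simp
  also have "\<dots> = (\<Sum>b\<in>B. inner x b * inner y b)"
    by (simp only: inner_sum_left inner_scaleR_left inner_commute[of y])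
  finally show ?thesis .
qed

text \<open>Basis independence of the real trace: expand in \<open>Basis\<close>, move
  \<open>f\<close> to its adjoint, and collapse the sum over \<open>B\<close> by Parseval.\<close>

lemma sum_inner_orthonormal_basis:
  fixes f :: "'a::euclidean_space \<Rightarrow> 'a"
  assumes "linear f"
    and B: "finite B" "pairwise orthogonal B" "\<And>b. b \<in> B \<Longrightarrow> norm b = 1" "span B = UNIV"
  shows "(\<Sum>b\<in>B. inner b (f b)) = (\<Sum>i\<in>Basis. inner i (f i))"
proof -
  have "(\<Sum>b\<in>B. inner b (f b)) = (\<Sum>b\<in>B. \<Sum>i\<in>Basis. inner b i * inner (f b) i)"
    by (intro sum.cong refl euclidean_inner)
  also have "\<dots> = (\<Sum>i\<in>Basis. \<Sum>b\<in>B. inner i b * inner (adjoint f i) b)"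
    by (subst sum.swap) (simp only: adjoint_clauses[OF assms(1)] inner_commute)
  also have "\<dots> = (\<Sum>i\<in>Basis. inner i (adjoint f i))"
    by (simp only: inner_orthonormal_expand[OF B, symmetric])
  also have "\<dots> = (\<Sum>i\<in>Basis. inner i (f i))"
    by (simp only: adjoint_clauses[OF assms(1)] inner_commute)
  finally show ?thesis .
qed

text \<open>The real basis consists of \<open>axis i 1\<close> and \<open>axis i \<i>\<close>. Both
  contribute the real part of the \<open>i\<close>-th diagonal entry, hence the division by
  2.\<close>

lemma Re_trace_eq_sum_Basis:
  fixes M :: "complex^'n^'n"
  shows "Re (trace M) = (\<Sum>b\<in>Basis. inner b (M *v b)) / 2"
proof -
  have diag: "(M *v axis i z) $ i = M $ i $ i * z" for i z
    by (simp add: matrix_vector_mult_def axis_def if_distrib cong: if_cong)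
  have quad: "inner (axis i z) (M *v axis i z) = Re (M $ i $ i)" if "z = 1 \<or> z = \<i>" for i z
    using that by (auto simp: inner_axis' diag inner_complex_def)
  have "Basis = (\<lambda>(i, z). axis i z :: complex^'n) ` (UNIV \<times> {1, \<i>})"
    by (auto simp: Basis_vec_def Basis_complex_def)
  moreover have "inj_on (\<lambda>(i, z). axis i z :: complex^'n) (UNIV \<times> {1, \<i>})"
    by (auto simp: inj_on_def axis_eq_axis)
  ultimately have "(\<Sum>b\<in>Basis. inner b (M *v b))
      = (\<Sum>(i, z)\<in>UNIV \<times> {1, \<i>}. inner (axis i z) (M *v axis i z))"
    by (intro sum.reindex_cong) auto
  also have "\<dots> = (\<Sum>i\<in>UNIV. \<Sum>z\<in>{1, \<i>}. inner (axis i z) (M *v axis i z))"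
    by (rule sum.cartesian_product[symmetric])
  also have "\<dots> = 2 * Re (trace M)"
    by (simp add: trace_def quad sum_distrib_left)
  finally show ?thesis by simp
qed

section \<open>The logarithm on eigenvectors\<close>

lemma fun_calc_eigenvector:
  assumes "hermitian A" "A *v v = complex_of_real x *s v"
  shows "fun_calc f A *v v = complex_of_real (f x) *s v"
  using theI'[OF is_fun_calc_ex1[OF assms(1), of f]] assms(2)
  unfolding fun_calc_def is_fun_calc_def by blast

text \<open>The case distinction in \<open>op_log\<close> disappears in the product: at
  \<open>x = 0\<close> both sides vanish.\<close>

lemma op_log_mult_eigenvector:
  assumes "hermitian A" "A *v v = complex_of_real x *s v"
  shows "(A ** op_log A) *v v = (x * ln x) *\<^sub>R v"
proof -
  have "op_log A *v v = (if x = 0 then 0 else ln x) *\<^sub>R v"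
    using fun_calc_eigenvector[OF assms, of "\<lambda>x. if x = 0 then 0 else ln x"]
    by (simp add: op_log_def cscale_real)
  with assms(2) show ?thesis
    by (auto simp: cscale_real linear_scale[OF matrix_vector_mul_linear]
        simp flip: matrix_vector_mul_assoc)
qed

lemma Re_cinner: "Re (cinner u v) = inner u v"
  by (simp add: cinner_def inner_vec_def inner_complex_def)

lemma psd_ops_iff: "A \<in> psd_ops \<longleftrightarrow> hermitian A \<and> (\<forall>v. 0 \<le> inner v (A *v v))"
  by (simp add: psd_ops_def Re_cinner)

section \<open>Peierls' inequality\<close>

text \<open>The left-hand side is the tangent at \<open>t\<close> to the convex function
  \<open>x * ln x\<close>. The bound is \<open>ln y \<le> y - 1\<close> at \<open>y = t / x\<close>,
  multiplied by \<open>x\<close>.\<close>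

lemma xlnx_tangent:
  fixes x t :: real
  assumes "0 \<le> x" "0 < t"
  shows "(ln t + 1) * x - t \<le> x * ln x"
proof (cases "x = 0")
  case False
  then have "ln (t / x) \<le> t / x - 1" using assms by (intro ln_le_minus_one) simp
  then have "x * ln (t / x) \<le> x * (t / x - 1)" using assms(1) by (rule mult_left_mono)
  then show ?thesis using False assms by (simp add: ln_div algebra_simps)
qed (use assms in simp)

lemma xlnx_continuous: "continuous_on {0..} (\<lambda>x::real. x * ln x)"
  unfolding continuous_on_def
proof
  fix x :: real assume "x \<in> {0..}"
  show "((\<lambda>x. x * ln x) \<longlongrightarrow> x * ln x) (at x within {0..})"
  proof (cases "x = 0")
    case True
    have "((\<lambda>x::real. x * ln x) \<longlongrightarrow> 0) (at_right 0)" by real_asymp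
    with True show ?thesis by (simp add: at_within_Ici_at_right)
  qed (intro tendsto_intros)
qed

text \<open>Jensen's inequality for \<open>x ln x\<close> and the spectral measure of \<open>A\<close> at \<open>e\<close>.\<close>

lemma op_log_quadratic_form_ge:
  assumes A: "A \<in> psd_ops" and e: "norm e = 1"
  shows "inner e (A *v e) * ln (inner e (A *v e)) \<le> inner e ((A ** op_log A) *v e)"
proof -
  have h: "hermitian A" using A by (simp add: psd_ops_iff)
  obtain B ev where B: "finite B" "pairwise orthogonal B" "\<And>b. b \<in> B \<Longrightarrow> norm b = 1"
      "span B = UNIV" and ev: "\<And>b. b \<in> B \<Longrightarrow> A *v b = complex_of_real (ev b) *s b"
    using hermitian_orthonormal_eigenbasis[OF h] by blast
  note expand = inner_orthonormal_expand[OF B]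
  have ev_ge: "0 \<le> ev b" if "b \<in> B" for b
    using A B(3)[OF that] ev[OF that] unfolding psd_ops_iff
    by (metis cscale_real inner_scaleR_right mult.right_neutral norm_eq_1)
  have e_expand: "e = (\<Sum>b\<in>B. inner e b *\<^sub>R b)"
    using orthonormal_basis_expand[of B e] B by simp
  have quad: "inner e (M *v e) = (\<Sum>b\<in>B. g b * (inner e b)\<^sup>2)"
    if "\<And>b. b \<in> B \<Longrightarrow> M *v b = g b *\<^sub>R b" for M g
  proof -
    have "M *v e = (\<Sum>b\<in>B. inner e b *\<^sub>R (M *v b))"
      by (subst e_expand)
        (simp add: linear_sum[OF matrix_vector_mul_linear] linear_scale[OF matrix_vector_mul_linear])
    then show ?thesis
      by (simp add: inner_sum_right that power2_eq_square mult_ac)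
  qed
  have qA: "inner e (A *v e) = (\<Sum>b\<in>B. ev b * (inner e b)\<^sup>2)"
    by (rule quad) (simp add: ev cscale_real)
  have qL: "inner e ((A ** op_log A) *v e) = (\<Sum>b\<in>B. (ev b * ln (ev b)) * (inner e b)\<^sup>2)"
    by (rule quad) (rule op_log_mult_eigenvector[OF h ev])
  have one: "(\<Sum>b\<in>B. (inner e b)\<^sup>2) = 1"
    using expand[of e e] e by (simp add: power2_eq_square norm_eq_1)
  \<comment> \<open>The squares of \<open>inner e b\<close> are weights of total mass 1, so
    averaging the tangent bound over the eigenvalues yields the tangent evaluated at their mean
    \<open>inner e (A *v e)\<close>.\<close>
  have lower: "(ln t + 1) * inner e (A *v e) - t \<le> inner e ((A ** op_log A) *v e)" if "0 < t" for t
  proof -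
    have "(ln t + 1) * inner e (A *v e) - t
        = (ln t + 1) * (\<Sum>b\<in>B. ev b * (inner e b)\<^sup>2) - t * (\<Sum>b\<in>B. (inner e b)\<^sup>2)"
      by (simp add: qA one)
    also have "\<dots> = (\<Sum>b\<in>B. ((ln t + 1) * ev b - t) * (inner e b)\<^sup>2)"
      by (simp only: sum_distrib_left left_diff_distrib sum_subtractf mult.assoc)
    also have "\<dots> \<le> inner e ((A ** op_log A) *v e)"
      unfolding qL by (intro sum_mono mult_right_mono xlnx_tangent ev_ge that) simp_all
    finally show ?thesis by simp
  qed
  have nonneg: "0 \<le> inner e (A *v e)" using A by (simp add: psd_ops_iff)
  show ?thesis
  proof (cases "inner e (A *v e) = 0")
    case True
    have "0 \<le> inner e ((A ** op_log A) *v e)"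
    \<comment> \<open>Tangents exist only at \<open>t > 0\<close>; for mean 0 the bound reads
      \<open>-t\<close>, and \<open>t\<close> tends to 0.\<close>
    proof (rule field_le_epsilon)
      fix t :: real assume "0 < t"
      from lower[OF this] True show "0 \<le> inner e ((A ** op_log A) *v e) + t" by simp
    qed
    with True show ?thesis by simp
  next
    case False
    then have "0 < inner e (A *v e)" using nonneg by simp
    \<comment> \<open>For a positive mean \<open>q\<close>, take \<open>t = q\<close>, where the
      tangent touches the graph.\<close>
    moreover have "(ln q + 1) * q - q = q * ln q" for q :: real
      by (simp add: algebra_simps)
    ultimately show ?thesis using lower by metis
  qed
qed

text \<open>\<open>m\<close> is the right-hand side of Peierls' inequality for an eigenbasis of \<open>\<gamma>\<close>.\<close>

lemma trace_mult_log_minorant: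
  fixes \<gamma> :: "complex^'n^'n"
  assumes "\<gamma> \<in> psd_ops"
  obtains m where "\<And>A. A \<in> psd_ops \<Longrightarrow> m A \<le> Re (trace (A ** op_log A))"
    "m \<gamma> = Re (trace (\<gamma> ** op_log \<gamma>))" "continuous_on psd_ops m"
proof -
  have h: "hermitian \<gamma>" using assms by (simp add: psd_ops_iff)
  obtain B ev where B: "finite B" "pairwise orthogonal B" "\<And>b. b \<in> B \<Longrightarrow> norm b = 1"
      "span B = UNIV" and ev: "\<And>b. b \<in> B \<Longrightarrow> \<gamma> *v b = complex_of_real (ev b) *s b"
    using hermitian_orthonormal_eigenbasis[OF h] by blast
  define m where "m A = (\<Sum>b\<in>B. inner b (A *v b) * ln (inner b (A *v b))) / 2" for A
  have tr: "Re (trace M) = (\<Sum>b\<in>B. inner b (M *v b)) / 2" for M :: "complex^'n^'n"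
    by (simp add: Re_trace_eq_sum_Basis sum_inner_orthonormal_basis[OF matrix_vector_mul_linear B])
  show thesis
  proof
    fix A :: "complex^'n^'n" assume "A \<in> psd_ops"
    then show "m A \<le> Re (trace (A ** op_log A))"
      unfolding tr m_def by (intro divide_right_mono sum_mono op_log_quadratic_form_ge B) simp_all
  next
    \<comment> \<open>For a unit eigenvector, \<open>inner b (\<gamma> *v b)\<close> is the
      eigenvalue itself, so Jensen's inequality is an equality.\<close>
    have "inner b (\<gamma> *v b) * ln (inner b (\<gamma> *v b)) = inner b ((\<gamma> ** op_log \<gamma>) *v b)"
      if "b \<in> B" for b
      using B(3)[OF that]
      by (simp add: op_log_mult_eigenvector[OF h ev[OF that]] ev[OF that] cscale_real norm_eq_1)
    then show "m \<gamma> = Re (trace (\<gamma> ** op_log \<gamma>))"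
      unfolding tr m_def by simp
  next
    have "continuous_on psd_ops (\<lambda>A. inner b (A *v b) * ln (inner b (A *v b)))" for b :: "complex^'n"
      by (rule continuous_on_compose2[OF xlnx_continuous])
        (auto simp: psd_ops_iff matrix_vector_mult_def inner_vec_def intro!: continuous_intros)
    then show "continuous_on psd_ops m"
      unfolding m_def by (intro continuous_on_divide continuous_on_sum continuous_on_const) simp_all
  qed
qed

section \<open>Lower semicontinuity of the entropies\<close>

lemma trace_mult_diff:
  fixes A B C :: "'a::comm_ring_1^'n^'n"
  shows "trace (A ** (B - C)) = trace (A ** B) - trace (A ** C)"
  by (simp add: trace_def matrix_matrix_mult_def right_diff_distrib sum_subtractf)

lemma continuous_on_Re_trace [continuous_intros]:
  fixes f :: "'x::topological_space \<Rightarrow> complex^'n^'n"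
  assumes "continuous_on S f"
  shows "continuous_on S (\<lambda>x. Re (trace (f x)))"
  using assms unfolding trace_def by (intro continuous_intros)

lemma continuous_on_matrix_mult [continuous_intros]:
  fixes f g :: "'x::topological_space \<Rightarrow> complex^'n^'n"
  assumes "continuous_on S f" "continuous_on S g"
  shows "continuous_on S (\<lambda>x. f x ** g x)"
  using assms unfolding matrix_matrix_mult_def by (intro continuous_intros)

text \<open>Subtracting the continuous term \<open>Re (trace A)\<close> turns a minorant of
  Tr[A log A] into one of the entropy. Continuity keeps it bounded along convergent families, so its
  product with \<epsilon> vanishes in the limit.\<close>

lemma vn_entropy_minorant:
  fixes \<gamma> :: "complex^'n^'n"
  assumes "\<gamma> \<in> psd_ops"
  obtains m :: "complex^'n^'n \<Rightarrow> real"
    where "\<And>A. A \<in> psd_ops \<Longrightarrow> m A \<le> vn_entropy A" "continuous_on psd_ops m"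
proof -
  obtain m :: "complex^'n^'n \<Rightarrow> real"
    where m: "\<And>A. A \<in> psd_ops \<Longrightarrow> m A \<le> Re (trace (A ** op_log A))" "continuous_on psd_ops m"
    using trace_mult_log_minorant[OF assms] by blast
  show thesis
  proof
    show "m A - Re (trace A) \<le> vn_entropy A" if "A \<in> psd_ops" for A
      using m(1)[OF that] by (simp add: vn_entropy_def trace_mult_diff)
    show "continuous_on psd_ops (\<lambda>A. m A - Re (trace A))"
      by (intro continuous_intros m(2))
  qed
qed

text \<open>If the kernel condition holds at \<gamma>, the Peierls minorant gives a continuous
  \<open>L\<close> below \<open>rel_entropy\<close> that agrees with it at \<gamma>. If it fails, it
  fails for all operators near \<gamma>, and both sides are infinite.\<close>

lemma rel_entropy_le_Liminf:
  fixes \<rho> \<gamma> :: "complex^'n^'n"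
  assumes "(u \<longlongrightarrow> \<gamma>) F" "\<gamma> \<in> psd_ops" "eventually (\<lambda>i. u i \<in> psd_ops) F" "F \<noteq> bot"
  shows "rel_entropy \<gamma> \<rho> \<le> Liminf F (\<lambda>i. rel_entropy (u i) \<rho>)"
proof (cases "op_kernel \<rho> \<subseteq> op_kernel \<gamma>")
  case True
  obtain m where m: "\<And>A. A \<in> psd_ops \<Longrightarrow> m A \<le> Re (trace (A ** op_log A))"
      "m \<gamma> = Re (trace (\<gamma> ** op_log \<gamma>))" "continuous_on psd_ops m"
    using trace_mult_log_minorant[OF assms(2)] by blast
  define L where "L A = m A - Re (trace (A ** op_log \<rho>)) - Re (trace A) + Re (trace \<rho>)" for A
  have "continuous_on psd_ops L"
    unfolding L_def by (intro continuous_intros m(3))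
  from continuous_on_tendsto_compose[OF this assms(1-3)]
  have "((\<lambda>i. L (u i)) \<longlongrightarrow> L \<gamma>) F" .
  then have lim: "Liminf F (\<lambda>i. ereal (L (u i))) = ereal (L \<gamma>)"
    using assms(4) by (intro lim_imp_Liminf) simp_all
  have expand: "rel_entropy A \<rho> = (if op_kernel \<rho> \<subseteq> op_kernel A
      then ereal (Re (trace (A ** op_log A)) - Re (trace (A ** op_log \<rho>)) - Re (trace A) + Re (trace \<rho>))
      else \<infinity>)" for A
    by (simp add: rel_entropy_def trace_mult_diff trace_add)
  have "rel_entropy \<gamma> \<rho> = ereal (L \<gamma>)"
    using True by (simp add: expand L_def m(2))
  also have "\<dots> = Liminf F (\<lambda>i. ereal (L (u i)))" by (rule lim[symmetric])
  also have "\<dots> \<le> Liminf F (\<lambda>i. rel_entropy (u i) \<rho>)"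
  proof (rule Liminf_mono)
    have "ereal (L A) \<le> rel_entropy A \<rho>" if "A \<in> psd_ops" for A
      using m(1)[OF that] by (simp add: expand L_def)
    then show "eventually (\<lambda>i. ereal (L (u i)) \<le> rel_entropy (u i) \<rho>) F"
      by (intro eventually_mono[OF assms(3)])
  qed
  finally show ?thesis .
next
  case False
  \<comment> \<open>The same \<open>v\<close> witnesses the failure for \<open>u i\<close>
    eventually, since \<open>u i *v v\<close> tends to a nonzero vector.\<close>
  then obtain v where v: "\<rho> *v v = 0" "\<gamma> *v v \<noteq> 0" by (auto simp: op_kernel_def)
  have "continuous_on UNIV (\<lambda>A. A *v v)"
    unfolding matrix_vector_mult_def by (intro continuous_intros)
  then have "((\<lambda>i. u i *v v) \<longlongrightarrow> \<gamma> *v v) F"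
    using assms(1) by (rule continuous_on_tendsto_compose) simp_all
  then have "eventually (\<lambda>i. u i *v v \<noteq> 0) F"
    using v(2) by (rule tendsto_imp_eventually_ne)
  then have "eventually (\<lambda>i. rel_entropy (u i) \<rho> = \<infinity>) F"
    by eventually_elim (use v(1) in \<open>auto simp: rel_entropy_def op_kernel_def\<close>)
  then have "Liminf F (\<lambda>i. rel_entropy (u i) \<rho>) = Liminf F (\<lambda>i. \<infinity>)"
    by (rule Liminf_eq)
  then show ?thesis using assms(4) by (simp add: Liminf_const)
qed

text \<open>Every \<open>c\<close> below \<open>x + y\<close> splits as \<open>c \<le> a + b\<close>
  with \<open>a < x\<close> and \<open>b < y\<close>, and eventually \<open>a < f i\<close> and
  \<open>b < g i\<close>. Excluding \<open>-\<infinity>\<close> for the two bounds rules out an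
  undefined sum, while \<open>\<infinity>\<close> stays allowed.\<close>

lemma add_le_Liminf_add:
  fixes f g :: "'i \<Rightarrow> ereal"
  assumes "x \<le> Liminf F f" "y \<le> Liminf F g" "x \<noteq> -\<infinity>" "y \<noteq> -\<infinity>"
  shows "x + y \<le> Liminf F (\<lambda>i. f i + g i)"
  unfolding le_Liminf_iff
proof (intro allI impI)
  fix c assume c: "c < x + y"
  have "\<exists>a b. a < x \<and> b < y \<and> c \<le> a + b"
  proof (cases c)
    case MInf
    then show ?thesis using assms(3,4) by (intro exI[of _ "-\<infinity>"]) auto
  next
    case (real r)
    consider (fin) p q where "x = ereal p" "y = ereal q" | (px) q where "x = \<infinity>" "y = ereal q"
      | (py) p where "x = ereal p" "y = \<infinity>" | (inf) "x = \<infinity>" "y = \<infinity>"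
      using assms(3,4) by (cases x; cases y) auto
    then show ?thesis
    proof cases
      case fin
      \<comment> \<open>Half of the gap \<open>p + q - r\<close> is taken from each summand, so the
        two witnesses add up to \<open>r\<close>.\<close>
      then show ?thesis using c real
        by (intro exI[of _ "ereal (p - (p + q - r) / 2)"] exI[of _ "ereal (q - (p + q - r) / 2)"])
          (auto simp: field_simps)
    next
      case px
      then show ?thesis using real
        by (intro exI[of _ "ereal (r - q + 1)"] exI[of _ "ereal (q - 1)"]) auto
    next
      case py
      then show ?thesis using real
        by (intro exI[of _ "ereal (p - 1)"] exI[of _ "ereal (r - p + 1)"]) auto
    next
      case inf
      then show ?thesis using real
        by (intro exI[of _ "ereal r"] exI[of _ "ereal 0"]) auto
    qed
  qed (use c in auto)
  then obtain a b where ab: "a < x" "b < y" "c \<le> a + b" by blast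
  have "eventually (\<lambda>i. a < f i) F" "eventually (\<lambda>i. b < g i) F"
    using assms(1,2) ab by (auto simp: le_Liminf_iff)
  then show "eventually (\<lambda>i. c < f i + g i) F"
    by eventually_elim (use ab(3) in \<open>metis ereal_add_strict_mono2 order_le_less_trans\<close>)
qed

section \<open>Positivity and continuity of the partial traces\<close>

lemma sum_UNIV_prod:
  fixes f :: "'a::finite \<times> 'b::finite \<Rightarrow> 'c::comm_monoid_add"
  shows "(\<Sum>p\<in>UNIV. f p) = (\<Sum>i\<in>UNIV. \<Sum>j\<in>UNIV. f (i, j))"
    and "(\<Sum>p\<in>UNIV. f p) = (\<Sum>j\<in>UNIV. \<Sum>i\<in>UNIV. f (i, j))"
proof -
  show "(\<Sum>p\<in>UNIV. f p) = (\<Sum>i\<in>UNIV. \<Sum>j\<in>UNIV. f (i, j))"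
    by (simp add: sum.cartesian_product)
  then show "(\<Sum>p\<in>UNIV. f p) = (\<Sum>j\<in>UNIV. \<Sum>i\<in>UNIV. f (i, j))"
    by (simp only: sum.swap[of "\<lambda>i j. f (i, j)"])
qed

text \<open>The quadratic form of the partial trace at \<open>v\<close> is the sum over
  \<open>k\<close> of the form of \<Gamma> at the product vectors of \<open>v\<close> with the
  \<open>k\<close>-th basis vector.\<close>

lemma ptrace2_in_psd_ops:
  fixes \<Gamma> :: "complex^('a::finite \<times> 'b::finite)^('a \<times> 'b)"
  assumes "\<Gamma> \<in> psd_ops"
  shows "ptrace2 \<Gamma> \<in> psd_ops"
  unfolding psd_ops_def
proof (intro CollectI conjI allI)
  have \<Gamma>: "\<Gamma> $ p $ q = cnj (\<Gamma> $ q $ p)" "0 \<le> Re (cinner w (\<Gamma> *v w))" for p q w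
    using assms unfolding psd_ops_def hermitian_def by blast+
  show "hermitian (ptrace2 \<Gamma>)"
    unfolding hermitian_def ptrace2_def by (auto intro!: sum.cong \<Gamma>(1))
  fix v :: "complex^'a"
  define w where "w k = (\<chi> p. if snd p = k then v $ fst p else 0)" for k :: 'b
  have row: "(\<Gamma> *v w k) $ (i, k) = (\<Sum>j\<in>UNIV. \<Gamma> $ (i, k) $ (j, k) * v $ j)" for i k
    by (simp add: matrix_vector_mult_def w_def sum_UNIV_prod(1) if_distrib cong: if_cong)
  have "cinner (w k) (\<Gamma> *v w k) = (\<Sum>i\<in>UNIV. cnj (v $ i) * (\<Gamma> *v w k) $ (i, k))" for k
    by (simp add: cinner_def w_def sum_UNIV_prod(1) if_distrib if_distribR cong: if_cong)
  moreover have "(ptrace2 \<Gamma> *v v) $ i = (\<Sum>k\<in>UNIV. (\<Gamma> *v w k) $ (i, k))" for i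
    unfolding row by (subst sum.swap) (simp add: matrix_vector_mult_def ptrace2_def sum_distrib_right)
  ultimately have "cinner v (ptrace2 \<Gamma> *v v) = (\<Sum>k\<in>UNIV. cinner (w k) (\<Gamma> *v w k))"
    by (simp add: cinner_def[of v] sum_distrib_left) (rule sum.swap)
  then show "0 \<le> Re (cinner v (ptrace2 \<Gamma> *v v))"
    by (simp add: sum_nonneg \<Gamma>(2))
qed

lemma ptrace1_in_psd_ops:
  fixes \<Gamma> :: "complex^('a::finite \<times> 'b::finite)^('a \<times> 'b)"
  assumes "\<Gamma> \<in> psd_ops"
  shows "ptrace1 \<Gamma> \<in> psd_ops"
  unfolding psd_ops_def
proof (intro CollectI conjI allI)
  have \<Gamma>: "\<Gamma> $ p $ q = cnj (\<Gamma> $ q $ p)" "0 \<le> Re (cinner w (\<Gamma> *v w))" for p q w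
    using assms unfolding psd_ops_def hermitian_def by blast+
  show "hermitian (ptrace1 \<Gamma>)"
    unfolding hermitian_def ptrace1_def by (auto intro!: sum.cong \<Gamma>(1))
  fix v :: "complex^'b"
  \<comment> \<open>The product vector with the basis vector now in the first factor.\<close>
  define w where "w k = (\<chi> p. if fst p = k then v $ snd p else 0)" for k :: 'a
  have row: "(\<Gamma> *v w k) $ (k, i) = (\<Sum>j\<in>UNIV. \<Gamma> $ (k, i) $ (k, j) * v $ j)" for i k
    by (simp add: matrix_vector_mult_def w_def sum_UNIV_prod(2) if_distrib cong: if_cong)
  have "cinner (w k) (\<Gamma> *v w k) = (\<Sum>i\<in>UNIV. cnj (v $ i) * (\<Gamma> *v w k) $ (k, i))" for k
    by (simp add: cinner_def w_def sum_UNIV_prod(2) if_distrib if_distribR cong: if_cong)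
  moreover have "(ptrace1 \<Gamma> *v v) $ i = (\<Sum>k\<in>UNIV. (\<Gamma> *v w k) $ (k, i))" for i
    unfolding row by (subst sum.swap) (simp add: matrix_vector_mult_def ptrace1_def sum_distrib_right)
  ultimately have "cinner v (ptrace1 \<Gamma> *v v) = (\<Sum>k\<in>UNIV. cinner (w k) (\<Gamma> *v w k))"
    by (simp add: cinner_def[of v] sum_distrib_left) (rule sum.swap)
  then show "0 \<le> Re (cinner v (ptrace1 \<Gamma> *v v))"
    by (simp add: sum_nonneg \<Gamma>(2))
qed

lemma continuous_on_ptrace:
  "continuous_on S ptrace1" "continuous_on S ptrace2"
  unfolding ptrace1_def ptrace2_def by (intro continuous_intros)+

section \<open>Liminf inequality and recovery families\<close>

theorem proposition3p3:
  fixes \<tau>1 \<tau>2 :: real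
    and C :: "complex^('a::finite \<times> 'b::finite)^('a \<times> 'b)"
    and \<rho> :: "complex^'a^'a"
    and \<sigma> :: "complex^'b^'b"
  assumes "\<tau>1 > 0" and "\<tau>2 > 0"
    and "hermitian C"
    and "\<rho> \<in> psd_ops" and "\<sigma> \<in> psd_ops"
  shows "Gamma_converges (subtopology weak_star_topology psd_ops)
           (\<lambda>\<epsilon>. cost \<tau>1 \<tau>2 C \<rho> \<sigma> \<epsilon>) (cost0 \<tau>1 \<tau>2 C \<rho> \<sigma>) (at_right 0)"
  unfolding Gamma_converges_def weak_star_topology_eq_euclidean
proof (intro conjI ballI allI impI)
  fix \<Gamma> :: "complex^('a \<times> 'b)^('a \<times> 'b)" and u
  assume "limitin (top_of_set psd_ops) u \<Gamma> (at_right (0 :: real))"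
  then have \<Gamma>: "\<Gamma> \<in> psd_ops" and ev: "eventually (\<lambda>\<epsilon>. u \<epsilon> \<in> psd_ops) (at_right 0)"
    and lim: "(u \<longlongrightarrow> \<Gamma>) (at_right 0)"
    by (auto simp: limitin_subtopology)
  obtain m :: "complex^('a \<times> 'b)^('a \<times> 'b) \<Rightarrow> real"
    where m: "\<And>A. A \<in> psd_ops \<Longrightarrow> m A \<le> vn_entropy A" "continuous_on psd_ops m"
    using vn_entropy_minorant[OF \<Gamma>] by blast
  \<comment> \<open>The finite part of the cost with the entropy replaced by its minorant. Since
    \<open>m (u \<epsilon>)\<close> converges, the second term tends to 0.\<close>
  define a where "a \<epsilon> = Re (trace (C ** u \<epsilon>)) + \<epsilon> * m (u \<epsilon>)" for \<epsilon>
  have "((\<lambda>\<epsilon>. Re (trace (C ** u \<epsilon>))) \<longlongrightarrow> Re (trace (C ** \<Gamma>))) (at_right 0)"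
    by (rule continuous_on_tendsto_compose[of UNIV, OF _ lim]) (auto intro!: continuous_intros)
  moreover have "((\<lambda>\<epsilon>. m (u \<epsilon>)) \<longlongrightarrow> m \<Gamma>) (at_right 0)"
    by (rule continuous_on_tendsto_compose[OF m(2) lim \<Gamma> ev])
  ultimately have "(a \<longlongrightarrow> Re (trace (C ** \<Gamma>)) + 0 * m \<Gamma>) (at_right 0)"
    unfolding a_def by (intro tendsto_add tendsto_mult tendsto_ident_at)
  then have "ereal (Re (trace (C ** \<Gamma>))) = Liminf (at_right 0) (\<lambda>\<epsilon>. ereal (a \<epsilon>))"
    by (intro lim_imp_Liminf[symmetric]) simp_all
  also have "\<dots> \<le> Liminf (at_right 0)
      (\<lambda>\<epsilon>. ereal (Re (trace (C ** u \<epsilon>))) + ereal (\<epsilon> * vn_entropy (u \<epsilon>)))"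
  proof (rule Liminf_mono)
    show "eventually (\<lambda>\<epsilon>. ereal (a \<epsilon>)
        \<le> ereal (Re (trace (C ** u \<epsilon>))) + ereal (\<epsilon> * vn_entropy (u \<epsilon>))) (at_right 0)"
      using ev eventually_at_right_less[of 0]
      by eventually_elim (simp add: a_def m(1) mult_left_mono)
  qed
  finally have linear: "ereal (Re (trace (C ** \<Gamma>))) \<le> Liminf (at_right 0)
      (\<lambda>\<epsilon>. ereal (Re (trace (C ** u \<epsilon>))) + ereal (\<epsilon> * vn_entropy (u \<epsilon>)))" .
  \<comment> \<open>Stated for a general continuous map \<open>p\<close> preserving positivity, so
    that it covers both partial traces.\<close>
  have rel: "ereal \<tau> * rel_entropy (p \<Gamma>) \<gamma>
      \<le> Liminf (at_right 0) (\<lambda>\<epsilon>. ereal \<tau> * rel_entropy (p (u \<epsilon>)) \<gamma>)"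
    if "0 < \<tau>" "continuous_on UNIV p" "\<And>A. A \<in> psd_ops \<Longrightarrow> p A \<in> psd_ops"
    for \<tau> and p :: "complex^('a \<times> 'b)^('a \<times> 'b) \<Rightarrow> complex^'c^'c" and \<gamma>
  proof -
    have "((\<lambda>\<epsilon>. p (u \<epsilon>)) \<longlongrightarrow> p \<Gamma>) (at_right 0)"
      by (rule continuous_on_tendsto_compose[OF that(2) lim]) simp_all
    moreover have "eventually (\<lambda>\<epsilon>. p (u \<epsilon>) \<in> psd_ops) (at_right 0)"
      using ev by eventually_elim (rule that(3))
    ultimately have "rel_entropy (p \<Gamma>) \<gamma> \<le> Liminf (at_right 0) (\<lambda>\<epsilon>. rel_entropy (p (u \<epsilon>)) \<gamma>)"
      by (intro rel_entropy_le_Liminf that(3) \<Gamma>) simp_all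
    with that(1) show ?thesis
      by (subst Liminf_ereal_mult_left) (auto intro: ereal_mult_left_mono)
  qed
  show "cost0 \<tau>1 \<tau>2 C \<rho> \<sigma> \<Gamma> \<le> Liminf (at_right 0) (\<lambda>\<epsilon>. cost \<tau>1 \<tau>2 C \<rho> \<sigma> \<epsilon> (u \<epsilon>))"
    unfolding cost0_def cost_def using assms(1,2)
    by (intro add_le_Liminf_add linear rel continuous_on_ptrace ptrace1_in_psd_ops ptrace2_in_psd_ops)
      (simp_all add: rel_entropy_def)
next
  fix \<Gamma> :: "complex^('a \<times> 'b)^('a \<times> 'b)"
  assume "\<Gamma> \<in> topspace (top_of_set psd_ops)"
  \<comment> \<open>For a constant family these terms do not depend on \<epsilon>. They may be
    infinite, but the part that varies is real, so the limit of the sum is well defined.\<close>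
  define r where "r = ereal \<tau>1 * rel_entropy (ptrace2 \<Gamma>) \<rho> + ereal \<tau>2 * rel_entropy (ptrace1 \<Gamma>) \<sigma>"
  have "((\<lambda>\<epsilon>. Re (trace (C ** \<Gamma>)) + \<epsilon> * vn_entropy \<Gamma>)
      \<longlongrightarrow> Re (trace (C ** \<Gamma>)) + 0 * vn_entropy \<Gamma>) (at_right 0)"
    by (intro tendsto_intros)
  then have "((\<lambda>\<epsilon>. ereal (Re (trace (C ** \<Gamma>)) + \<epsilon> * vn_entropy \<Gamma>) + r)
      \<longlongrightarrow> ereal (Re (trace (C ** \<Gamma>))) + r) (at_right 0)"
    by (intro tendsto_add_ereal_general2) simp_all
  then have "((\<lambda>\<epsilon>. cost \<tau>1 \<tau>2 C \<rho> \<sigma> \<epsilon> \<Gamma>) \<longlongrightarrow> cost0 \<tau>1 \<tau>2 C \<rho> \<sigma> \<Gamma>) (at_right 0)"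
    by (simp add: cost_def cost0_def r_def add.assoc flip: plus_ereal.simps(1))
  then have "Limsup (at_right 0) (\<lambda>\<epsilon>. cost \<tau>1 \<tau>2 C \<rho> \<sigma> \<epsilon> \<Gamma>) = cost0 \<tau>1 \<tau>2 C \<rho> \<sigma> \<Gamma>"
    by (intro lim_imp_Limsup) simp_all
  with \<open>\<Gamma> \<in> topspace (top_of_set psd_ops)\<close>
  show "\<exists>u. limitin (top_of_set psd_ops) u \<Gamma> (at_right 0) \<and>
      Limsup (at_right 0) (\<lambda>\<epsilon>. cost \<tau>1 \<tau>2 C \<rho> \<sigma> \<epsilon> (u \<epsilon>)) \<le> cost0 \<tau>1 \<tau>2 C \<rho> \<sigma> \<Gamma>"
    by (intro exI[of _ "\<lambda>_. \<Gamma>"]) simp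
qed

end
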